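(* Let $N\geq 1$, let $\mathcal{K}_N$ be the algebra of the Kronecker quiver with $N$ arrows, and let $\mathfrak{g}\subseteq\operatorname{Der}(\mathcal{K}_N)$ be a Lie algebra of derivations. Then $\Omega^k_{\mathfrak{g}}=0$ for all $k\geq 2$.
   Context: $\mathcal{K}_N$ is the unital associative $\mathbb{C}$-algebra generated by $e,\alpha_1,\ldots,\alpha_N$ subject to $e^2=e$, $e\alpha_k=\alpha_k$, $\alpha_k e=0$, $\alpha_j\alpha_k=0$ for all $j,k\in\{1,\ldots,N\}$; the elements $1,e,\alpha_1,\ldots,\alpha_N$ form a vector space basis of it. It is a $\ast$-algebra (conjugate-linear, anti-multiplicative involution) with $e^\ast=1-e$ and $\alpha_i^\ast=\alpha_i$. $\operatorname{Der}(\mathcal{K}_N)$ is the complex Lie algebra of $\mathbb{C}$-linear derivations of $\mathcal{K}_N$, and $\partial^\ast(a)=(\partial(a^\ast))^\ast$ for a derivation $\partial$. A Lie algebra $\mathfrak{g}\subseteq\operatorname{Der}(\mathcal{K}_N)$ is always assumed to be a complex Lie subalgebra closed under $\partial\mapsto\partial^\ast$ (the center of $\mathcal{K}_N$ is $\mathbb{C}1$, so $\mathfrak g$ is a module over the center). The restricted differential calculus: for $a\in\mathcal{K}_N$, $da:\mathfrak{g}\to\mathcal{K}_N$ is $da(\partial)=\partial(a)$. For $k\ge 1$, $\Omega^k_{\mathfrak{g}}$ is the set of finite sums of the alternating multilinear maps $a_0\,da_1\cdots da_k:\mathfrak{g}^k\to\mathcal{K}_N$, with $a_0,\ldots,a_k\in\mathcal{K}_N$,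 given by $$a_0\,da_1\cdots da_k(\partial_1,\ldots,\partial_k)=\sum_{\sigma\in S_k}\operatorname{sgn}(\sigma)\,a_0\,\partial_{\sigma(1)}(a_1)\cdots \partial_{\sigma(k)}(a_k).$$ *)

theory Defs
  imports Complex_Main "HOL-Library.FuncSet" "HOL-Combinatorics.Permutations"
begin

text \<open>
  The algebra of the Kronecker quiver, given by generators and relations: terms over the
  generators, modulo the least congruence that contains the axioms of unital associative complex
  algebras and the defining relations. The arrows are indexed by a type \<open>'n\<close>; for a finite type
  this is the algebra with \<open>N = CARD('n) \<ge> 1\<close> arrows.
\<close>

datatype 'n kexpr =
    Scalar complex
  | Idem
  | Arrow 'n
  | Add "'n kexpr" "'n kexpr"
  | Mult "'n kexpr" "'n kexpr"

inductive kcong :: "'n kexpr \<Rightarrow> 'n kexpr \<Rightarrow> bool" where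
  kcong_refl: "kcong x x"
| kcong_sym: "kcong x y \<Longrightarrow> kcong y x"
| kcong_trans: "kcong x y \<Longrightarrow> kcong y z \<Longrightarrow> kcong x z"
| kcong_add: "kcong x x' \<Longrightarrow> kcong y y' \<Longrightarrow> kcong (Add x y) (Add x' y')"
| kcong_mult: "kcong x x' \<Longrightarrow> kcong y y' \<Longrightarrow> kcong (Mult x y) (Mult x' y')"
| kcong_add_assoc: "kcong (Add (Add x y) z) (Add x (Add y z))"
| kcong_add_commute: "kcong (Add x y) (Add y x)"
| kcong_add_zero: "kcong (Add (Scalar 0) x) x"
| kcong_add_inverse: "kcong (Add (Mult (Scalar (-1)) x) x) (Scalar 0)"
| kcong_mult_assoc: "kcong (Mult (Mult x y) z) (Mult x (Mult y z))"
| kcong_mult_one: "kcong (Mult (Scalar 1) x) x"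
| kcong_distrib_left: "kcong (Mult x (Add y z)) (Add (Mult x y) (Mult x z))"
| kcong_distrib_right: "kcong (Mult (Add x y) z) (Add (Mult x z) (Mult y z))"
| kcong_scalar_add: "kcong (Scalar (c + d)) (Add (Scalar c) (Scalar d))"
| kcong_scalar_mult: "kcong (Scalar (c * d)) (Mult (Scalar c) (Scalar d))"
| kcong_scalar_central: "kcong (Mult (Scalar c) x) (Mult x (Scalar c))"
| kcong_idem_idem: "kcong (Mult Idem Idem) Idem"
| kcong_idem_arrow: "kcong (Mult Idem (Arrow k)) (Arrow k)"
| kcong_arrow_idem: "kcong (Mult (Arrow k) Idem) (Scalar 0)"
| kcong_arrow_arrow: "kcong (Mult (Arrow j) (Arrow k)) (Scalar 0)"

quotient_type 'n kronecker = "'n kexpr" / kcong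
  by (rule equivpI) (auto intro!: reflpI sympI transpI intro: kcong_refl kcong_sym kcong_trans)

lift_definition kscalar :: "complex \<Rightarrow> 'n kronecker" is Scalar .
lift_definition kidem :: "'n kronecker" is Idem .
lift_definition karrow :: "'n \<Rightarrow> 'n kronecker" is Arrow .

instantiation kronecker :: (type) ring
begin

lift_definition zero_kronecker :: "'a kronecker" is "Scalar 0" .
lift_definition plus_kronecker :: "'a kronecker \<Rightarrow> 'a kronecker \<Rightarrow> 'a kronecker" is Add
  by (rule kcong_add)
lift_definition times_kronecker :: "'a kronecker \<Rightarrow> 'a kronecker \<Rightarrow> 'a kronecker" is Mult
  by (rule kcong_mult)
definition uminus_kronecker :: "'a kronecker \<Rightarrow> 'a kronecker"
  where "- x = kscalar (-1) * x"
definition minus_kronecker :: "'a kronecker \<Rightarrow> 'a kronecker \<Rightarrow> 'a kronecker"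
  where "x - y = x + - (y :: 'a kronecker)"

instance
proof
  fix a b c :: "'a kronecker"
  show "a + b + c = a + (b + c)" by transfer (rule kcong_add_assoc)
  show "a + b = b + a" by transfer (rule kcong_add_commute)
  show "0 + a = a" by transfer (rule kcong_add_zero)
  show "- a + a = 0" unfolding uminus_kronecker_def by transfer (rule kcong_add_inverse)
  show "a - b = a + - b" by (rule minus_kronecker_def)
  show "a * b * c = a * (b * c)" by transfer (rule kcong_mult_assoc)
  show "(a + b) * c = a * c + b * c" by transfer (rule kcong_distrib_right)
  show "a * (b + c) = a * b + a * c" by transfer (rule kcong_distrib_left)
qed

end

text \<open>Coordinates with respect to \<open>1, e, \<alpha>\<^sub>i\<close>, which show that these are linearly independent.\<close>

primrec kcoord0 :: "'n kexpr \<Rightarrow> complex" where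
  "kcoord0 (Scalar c) = c"
| "kcoord0 Idem = 0"
| "kcoord0 (Arrow k) = 0"
| "kcoord0 (Add x y) = kcoord0 x + kcoord0 y"
| "kcoord0 (Mult x y) = kcoord0 x * kcoord0 y"

primrec kcoord1 :: "'n kexpr \<Rightarrow> complex" where
  "kcoord1 (Scalar c) = 0"
| "kcoord1 Idem = 1"
| "kcoord1 (Arrow k) = 0"
| "kcoord1 (Add x y) = kcoord1 x + kcoord1 y"
| "kcoord1 (Mult x y) = kcoord0 x * kcoord1 y + kcoord1 x * kcoord0 y + kcoord1 x * kcoord1 y"

primrec kcoord2 :: "'n kexpr \<Rightarrow> 'n \<Rightarrow> complex" where
  "kcoord2 (Scalar c) i = 0"
| "kcoord2 Idem i = 0"
| "kcoord2 (Arrow k) i = (if i = k then 1 else 0)"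
| "kcoord2 (Add x y) i = kcoord2 x i + kcoord2 y i"
| "kcoord2 (Mult x y) i = (kcoord0 x + kcoord1 x) * kcoord2 y i + kcoord2 x i * kcoord0 y"

lemma kcoord0_cong: "kcong x y \<Longrightarrow> kcoord0 x = kcoord0 y"
  by (induction rule: kcong.induct) (simp_all add: algebra_simps)

lemma kcoord1_cong: "kcong x y \<Longrightarrow> kcoord1 x = kcoord1 y"
  by (induction rule: kcong.induct) (simp_all add: algebra_simps kcoord0_cong)

lemma kcoord2_cong: "kcong x y \<Longrightarrow> kcoord2 x i = kcoord2 y i"
  by (induction rule: kcong.induct) (simp_all add: algebra_simps kcoord0_cong kcoord1_cong)

lift_definition kcoord :: "'n kronecker \<Rightarrow> complex \<times> complex \<times> ('n \<Rightarrow> complex)"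
  is "\<lambda>x. (kcoord0 x, kcoord1 x, kcoord2 x)"
  by (auto simp: fun_eq_iff dest: kcoord0_cong kcoord1_cong kcoord2_cong)

lemma kcoord_simps:
  "kcoord 0 = (0, 0, \<lambda>_. 0)"
  "kcoord (kscalar c) = (c, 0, \<lambda>_. 0)"
  "kcoord kidem = (0, 1, \<lambda>_. 0)"
  "kcoord (karrow k) = (0, 0, \<lambda>i. if i = k then 1 else 0)"
  "kcoord (x + y) = (case (kcoord x, kcoord y) of ((a, b, f), (a', b', f')) \<Rightarrow>
     (a + a', b + b', \<lambda>i. f i + f' i))"
  "kcoord (x * y) = (case (kcoord x, kcoord y) of ((a, b, f), (a', b', f')) \<Rightarrow>
     (a * a', a * b' + b * a' + b * b', \<lambda>i. (a + b) * f' i + f i * a'))"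
  by (transfer; simp add: fun_eq_iff)+

instantiation kronecker :: (type) ring_1
begin

definition one_kronecker :: "'a kronecker" where "1 = kscalar 1"

instance
proof
  fix a :: "'a kronecker"
  have central: "kscalar c * a = a * kscalar c" for c
    by transfer (rule kcong_scalar_central)
  show "1 * a = a" unfolding one_kronecker_def by transfer (rule kcong_mult_one)
  then show "a * 1 = a" unfolding one_kronecker_def using central by metis
  have "kcoord (0 :: 'a kronecker) \<noteq> kcoord (1 :: 'a kronecker)"
    by (simp add: one_kronecker_def kcoord_simps)
  then show "(0 :: 'a kronecker) \<noteq> 1" by metis
qed

end

definition kscale :: "complex \<Rightarrow> 'n kronecker \<Rightarrow> 'n kronecker"
  where "kscale c x = kscalar c * x"

lemma kscalar_central: "kscalar c * x = x * kscalar c"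
  by transfer (rule kcong_scalar_central)

lemma kscalar_0: "kscalar 0 = 0" by transfer (rule kcong_refl)
lemma kscalar_1: "kscalar 1 = 1" by (simp add: one_kronecker_def)
lemma kscalar_add: "kscalar (c + d) = kscalar c + kscalar d" by transfer (rule kcong_scalar_add)
lemma kscalar_mult: "kscalar (c * d) = kscalar c * kscalar d" by transfer (rule kcong_scalar_mult)

interpretation kronecker: vector_space kscale
  by standard
    (simp_all add: kscale_def kscalar_1 kscalar_add kscalar_mult distrib_left distrib_right
      mult.assoc)

lemma kscale_mult:
  "kscale c x * y = kscale c (x * y)" "x * kscale c y = kscale c (x * y)"
proof -
  show "kscale c x * y = kscale c (x * y)" by (simp add: kscale_def mult.assoc)
  have "x * kscale c y = x * kscalar c * y" by (simp add: kscale_def mult.assoc)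
  also have "\<dots> = kscale c (x * y)"
    by (simp only: kscale_def kscalar_central [symmetric] mult.assoc)
  finally show "x * kscale c y = kscale c (x * y)" .
qed

lemma kronecker_relations:
  "kidem * kidem = kidem"
  "kidem * karrow k = karrow k"
  "karrow k * kidem = 0"
  "karrow j * karrow k = 0"
  by (transfer, rule kcong_idem_idem kcong_idem_arrow kcong_arrow_idem kcong_arrow_arrow)+

lemma kronecker_induct [case_names scalar idem arrow add mult]:
  assumes "\<And>c. P (kscalar c)" "P kidem" "\<And>k. P (karrow k)"
    and "\<And>x y. P x \<Longrightarrow> P y \<Longrightarrow> P (x + y)" "\<And>x y. P x \<Longrightarrow> P y \<Longrightarrow> P (x * y)"
  shows "P (x :: 'n kronecker)"
proof -
  have "P (abs_kronecker t)" for t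
    by (induction t)
      (use assms in \<open>simp_all add: kscalar.abs_eq kidem.abs_eq karrow.abs_eq
         flip: plus_kronecker.abs_eq times_kronecker.abs_eq
         kscalar.abs_eq kidem.abs_eq karrow.abs_eq\<close>)
  then show ?thesis
    by (metis Quotient3_kronecker Quotient3_abs_rep)
qed

definition kcomb :: "complex \<times> complex \<times> ('n::finite \<Rightarrow> complex) \<Rightarrow> 'n kronecker"
  where "kcomb p = (case p of (a, b, f) \<Rightarrow>
    kscale a 1 + kscale b kidem + (\<Sum>i\<in>UNIV. kscale (f i) (karrow i)))"

lemma kcoord_kscale: "kcoord (kscale c x) = (case kcoord x of (a, b, f) \<Rightarrow> (c * a, c * b, \<lambda>i. c * f i))"
  by (simp add: kscale_def kcoord_simps)

lemma kcoord_1: "kcoord 1 = (1, 0, \<lambda>_. 0)"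
  by (simp add: one_kronecker_def kcoord_simps)

lemma kcoord_sum:
  "finite A \<Longrightarrow> kcoord (\<Sum>i\<in>A. kscale (f i) (karrow i)) = (0, 0, \<lambda>i. if i \<in> A then f i else 0)"
  by (induction A rule: finite_induct)
    (auto simp: kcoord_simps kcoord_kscale fun_eq_iff)

lemma kcoord_kcomb: "kcoord (kcomb p) = p"
  by (cases p) (simp add: kcomb_def kcoord_simps kcoord_sum kcoord_kscale kcoord_1)

lemma kcomb_kcoord: "kcomb (kcoord x) = (x :: 'n::finite kronecker)"
proof -
  have kcomb_add: "kcomb (a, b, f) + kcomb (a', b', f') = kcomb (a + a', b + b', \<lambda>i. f i + f' i)"
    for a b a' b' :: complex and f f' :: "'n \<Rightarrow> complex"
    by (simp add: kcomb_def kronecker.scale_left_distrib sum.distrib)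
  have kcomb_mult: "kcomb (a, b, f) * kcomb (a', b', f') =
      kcomb (a * a', a * b' + b * a' + b * b', \<lambda>i. (a + b) * f' i + f i * a')"
    for a b a' b' :: complex and f f' :: "'n \<Rightarrow> complex"
    by (simp add: kcomb_def kronecker.scale_left_distrib sum.distrib distrib_left distrib_right
        sum_distrib_left sum_distrib_right kscale_mult kronecker_relations
        kronecker.scale_sum_right kronecker.scale_right_distrib ac_simps)
  have "\<exists>p. x = kcomb p"
  proof (induction x rule: kronecker_induct)
    case (scalar c)
    show ?case by (rule exI[of _ "(c, 0, \<lambda>_. 0)"]) (simp add: kcomb_def, simp add: kscale_def)
  next
    case idem
    show ?case by (rule exI[of _ "(0, 1, \<lambda>_. 0)"]) (simp add: kcomb_def)
  next
    case (arrow k)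
    have "(\<Sum>i\<in>UNIV. kscale (if i = k then 1 else 0) (karrow i)) =
        (\<Sum>i\<in>UNIV. if i = k then karrow i else 0 :: 'n kronecker)"
      by (rule sum.cong) auto
    then show ?case
      by (intro exI[of _ "(0, 0, \<lambda>i. if i = k then 1 else 0)"]) (simp add: kcomb_def)
  next
    case (add x y)
    then obtain p q where "x = kcomb p" "y = kcomb q" by blast
    then show ?case by (cases p; cases q) (auto simp: kcomb_add)
  next
    case (mult x y)
    then obtain p q where "x = kcomb p" "y = kcomb q" by blast
    then show ?case by (cases p; cases q) (auto simp: kcomb_mult)
  qed
  then show ?thesis by (auto simp: kcoord_kcomb)
qed

lemma kronecker_basis:
  "\<exists>!(a, b, f). (x :: 'n::finite kronecker) = kscale a 1 + kscale b kidem + (\<Sum>i\<in>UNIV. kscale (f i) (karrow i))"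
proof -
  have "\<exists>!p. x = kcomb p" by (metis kcoord_kcomb kcomb_kcoord)
  then show ?thesis by (simp add: kcomb_def case_prod_unfold)
qed

primrec kexpr_star :: "'n kexpr \<Rightarrow> 'n kexpr" where
  "kexpr_star (Scalar c) = Scalar (cnj c)"
| "kexpr_star Idem = Add (Scalar 1) (Mult (Scalar (-1)) Idem)"
| "kexpr_star (Arrow k) = Arrow k"
| "kexpr_star (Add x y) = Add (kexpr_star x) (kexpr_star y)"
| "kexpr_star (Mult x y) = Mult (kexpr_star y) (kexpr_star x)"

lemma kexpr_star_cong:
  assumes "kcong x y"
  shows "kcong (kexpr_star x) (kexpr_star y)"
proof -
  have abs: "abs_kronecker (Scalar c) = kscalar c" "abs_kronecker Idem = kidem"
    "abs_kronecker (Arrow k) = karrow k"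
    "abs_kronecker (Add s t) = abs_kronecker s + abs_kronecker t"
    "abs_kronecker (Mult s t) = abs_kronecker s * abs_kronecker t"
    for c and k :: 'a and s t :: "'a kexpr"
    by (simp_all add: kscalar.abs_eq kidem.abs_eq karrow.abs_eq
        plus_kronecker.abs_eq times_kronecker.abs_eq)
  have neg: "kscalar (-1) * z = - z" "z * kscalar (-1) = - z" for z :: "'a kronecker"
    by (simp_all add: uminus_kronecker_def kscalar_central)
  have "abs_kronecker (kexpr_star x) = abs_kronecker (kexpr_star y)"
    using assms
  proof (induction rule: kcong.induct)
    case (kcong_scalar_mult c d)
    then show ?case by (simp add: abs kscalar_mult) (rule kscalar_central)
  next
    case (kcong_scalar_central c x)
    then show ?case by (simp add: abs) (metis kscalar_central)
  qed (simp_all add: abs neg kscalar_0 kscalar_1 kscalar_add kronecker_relations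
      mult.assoc distrib_left distrib_right left_diff_distrib right_diff_distrib add.assoc add.commute)
  then show ?thesis by (simp add: kronecker.abs_eq_iff)
qed

text \<open>The involution is determined by \<open>e\<^sup>* = 1 - e\<close> and \<open>\<alpha>\<^sub>i\<^sup>* = \<alpha>\<^sub>i\<close>.\<close>

lift_definition kstar :: "'n kronecker \<Rightarrow> 'n kronecker" is kexpr_star
  by (rule kexpr_star_cong)

lemma kstar_simps:
  "kstar (kscalar c) = kscalar (cnj c)"
  "kstar (karrow k) = karrow k"
  "kstar (x + y) = kstar x + kstar y"
  "kstar (x * y) = kstar y * kstar x"
  by (transfer; simp add: kcong_refl)+

lemma kstar_kidem: "kstar kidem = 1 - kidem"
  unfolding one_kronecker_def minus_kronecker_def uminus_kronecker_def
  by transfer (simp add: kcong_refl)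

lemma kstar_kscale: "kstar (kscale c x) = kscale (cnj c) (kstar x)"
  by (simp add: kscale_def kstar_simps kscalar_central)

lemma kstar_kstar: "kstar (kstar x) = x"
proof (induction x rule: kronecker_induct)
  case idem
  have "kstar (1 - kidem + kidem :: 'a kronecker) = 1"
    using kstar_simps(1)[of 1] by (simp add: kscalar_1)
  then have "kstar (1 - kidem) + kstar kidem = (1 :: 'a kronecker)"
    by (simp only: kstar_simps)
  then show ?case by (simp add: kstar_kidem algebra_simps)
qed (simp_all add: kstar_simps)

definition derivation :: "('n kronecker \<Rightarrow> 'n kronecker) \<Rightarrow> bool" where
  "derivation D \<longleftrightarrow>
     (\<forall>x y. D (x + y) = D x + D y) \<and>
     (\<forall>c x. D (kscale c x) = kscale c (D x)) \<and>
     (\<forall>x y. D (x * y) = D x * y + x * D y)"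

definition lie_algebra_of_derivations :: "('n kronecker \<Rightarrow> 'n kronecker) set \<Rightarrow> bool" where
  "lie_algebra_of_derivations \<gg> \<longleftrightarrow>
     \<gg> \<subseteq> Collect derivation \<and>
     (\<lambda>_. 0) \<in> \<gg> \<and>
     (\<forall>D\<in>\<gg>. \<forall>E\<in>\<gg>. (\<lambda>x. D x + E x) \<in> \<gg>) \<and>
     (\<forall>c. \<forall>D\<in>\<gg>. (\<lambda>x. kscale c (D x)) \<in> \<gg>) \<and>
     (\<forall>D\<in>\<gg>. \<forall>E\<in>\<gg>. (\<lambda>x. D (E x) - E (D x)) \<in> \<gg>) \<and>
     (\<forall>D\<in>\<gg>. (\<lambda>x. kstar (D (kstar x))) \<in> \<gg>)"

text \<open>
  A \<open>k\<close>-form is a function on \<open>\<gg>\<^sup>k\<close>, whose elements are the extensional functions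
  \<open>{1..k} \<rightarrow>\<^sub>E \<gg>\<close>. Forms are themselves extensional (\<open>undefined\<close> outside \<open>\<gg>\<^sup>k\<close>), so that equality
  of forms is equality of their values on \<open>\<gg>\<^sup>k\<close>.
\<close>

definition differential ::
    "('n kronecker \<Rightarrow> 'n kronecker) set \<Rightarrow> 'n kronecker \<Rightarrow>
     ('n kronecker \<Rightarrow> 'n kronecker) \<Rightarrow> 'n kronecker" where
  "differential \<gg> a = (\<lambda>D\<in>\<gg>. D a)"

text \<open>\<open>basic_form \<gg> k a\<close> is \<open>a\<^sub>0 da\<^sub>1 \<dots> da\<^sub>k\<close>; the factors are multiplied in this order.\<close>

definition basic_form ::
    "('n kronecker \<Rightarrow> 'n kronecker) set \<Rightarrow> nat \<Rightarrow> (nat \<Rightarrow> 'n kronecker) \<Rightarrow>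
     (nat \<Rightarrow> 'n kronecker \<Rightarrow> 'n kronecker) \<Rightarrow> 'n kronecker" where
  "basic_form \<gg> k a = (\<lambda>D \<in> {1..k} \<rightarrow>\<^sub>E \<gg>.
     \<Sum>\<sigma> | \<sigma> permutes {1..k}.
       of_int (sign \<sigma>) * (a 0 * prod_list (map (\<lambda>i. differential \<gg> (a i) (D (\<sigma> i))) [1..<Suc k])))"

definition zero_form ::
    "('n kronecker \<Rightarrow> 'n kronecker) set \<Rightarrow> nat \<Rightarrow>
     (nat \<Rightarrow> 'n kronecker \<Rightarrow> 'n kronecker) \<Rightarrow> 'n kronecker" where
  "zero_form \<gg> k = (\<lambda>D \<in> {1..k} \<rightarrow>\<^sub>E \<gg>. 0)"

definition Omega ::
    "('n kronecker \<Rightarrow> 'n kronecker) set \<Rightarrow> nat \<Rightarrow>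
     ((nat \<Rightarrow> 'n kronecker \<Rightarrow> 'n kronecker) \<Rightarrow> 'n kronecker) set" where
  "Omega \<gg> k = {\<omega>. \<exists>as. \<omega> = (\<lambda>D \<in> {1..k} \<rightarrow>\<^sub>E \<gg>. \<Sum>a\<leftarrow>as. basic_form \<gg> k a D)}"

end

theory Submission
  imports Defs
begin

text \<open>
  Let \<open>J\<close> be the set of all \<open>x\<close> with \<open>e x = x\<close> and \<open>x e = 0\<close>; in terms of the basis this is the span
  of the arrows. Two facts prove the theorem. First, \<open>J J = 0\<close>, because
  \<open>x y = x (e y) = (x e) y = 0\<close>. Second, every derivation takes all its values in \<open>J\<close>. So any two
  adjacent factors \<open>\<partial>\<^sub>\<sigma>\<^sub>(\<^sub>i\<^sub>)(a\<^sub>i)\<close> and \<open>\<partial>\<^sub>\<sigma>\<^sub>(\<^sub>i\<^sub>+\<^sub>1\<^sub>)(a\<^sub>i\<^sub>+\<^sub>1)\<close> multiply to zero, and as soon as \<open>k \<ge> 2\<close> each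
  summand of \<open>a\<^sub>0 da\<^sub>1 \<dots> da\<^sub>k\<close> vanishes separately, without any cancellation between permutations.

  The second fact is checked on the generators and carried to products by the Leibniz rule. Both
  steps rest on the left ideal generated by \<open>e\<close> being the line \<open>\<complex> e\<close>: it makes \<open>J\<close> a two-sided
  ideal, and it forces \<open>(1 - e) \<partial>(e) e = 0\<close>, a component of \<open>\<partial>(e)\<close> on which the relation
  \<open>e\<^sup>2 = e\<close> puts no condition.
\<close>

definition arrow_ideal :: "'n kronecker set" where
  "arrow_ideal = {x. kidem * x = x \<and> x * kidem = 0}"

lemma arrow_ideal_mult_eq_0:
  assumes "x \<in> arrow_ideal" "y \<in> arrow_ideal"
  shows "x * y = 0"
proof -
  have "x * y = x * (kidem * y)" using assms(2) by (simp add: arrow_ideal_def)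
  also have "\<dots> = (x * kidem) * y" by (simp only: mult.assoc)
  finally show ?thesis using assms(1) by (simp add: arrow_ideal_def)
qed

text \<open>
  In quiver terms, \<open>e\<close> is the only path \<open>p\<close> with \<open>p e \<noteq> 0\<close>: right multiplication by \<open>e\<close> kills the
  other trivial path \<open>1 - e\<close> and all arrows.
\<close>

lemma mult_kidem_eq_kscale: "\<exists>c. x * kidem = kscale c kidem"
proof (induction x rule: kronecker_induct)
  case (scalar c)
  show ?case by (auto simp: kscale_def)
next
  case idem
  show ?case by (rule exI[of _ 1]) (simp add: kronecker_relations)
next
  case (arrow k)
  show ?case by (rule exI[of _ 0]) (simp add: kronecker_relations)
next
  case (add x y)
  then show ?case by (metis distrib_right kronecker.scale_left_distrib)
next
  case (mult x y)
  then obtain c d where "x * kidem = kscale c kidem" "y * kidem = kscale d kidem" by blast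
  then have "(x * y) * kidem = kscale (d * c) kidem"
    by (simp add: mult.assoc kscale_mult)
  then show ?case by blast
qed

lemma arrow_ideal_0: "0 \<in> arrow_ideal"
  by (simp add: arrow_ideal_def)

lemma arrow_ideal_add: "x \<in> arrow_ideal \<Longrightarrow> y \<in> arrow_ideal \<Longrightarrow> x + y \<in> arrow_ideal"
  by (simp add: arrow_ideal_def distrib_left distrib_right)

lemma arrow_ideal_mult_right:
  assumes "x \<in> arrow_ideal"
  shows "x * y \<in> arrow_ideal"
proof -
  obtain c where c: "y * kidem = kscale c kidem" using mult_kidem_eq_kscale by blast
  have "kidem * (x * y) = x * y"
    using assms by (simp add: arrow_ideal_def flip: mult.assoc)
  moreover have "x * y * kidem = 0"
    using assms by (simp add: mult.assoc c kscale_mult arrow_ideal_def)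
  ultimately show ?thesis by (simp add: arrow_ideal_def)
qed

lemma arrow_ideal_mult_left:
  assumes "y \<in> arrow_ideal"
  shows "x * y \<in> arrow_ideal"
proof -
  obtain c where c: "x * kidem = kscale c kidem" using mult_kidem_eq_kscale by blast
  have "x * y = (x * kidem) * y"
    using assms by (simp add: arrow_ideal_def mult.assoc)
  \<comment> \<open>Left multiplication by \<open>x\<close> acts on the ideal as a scalar.\<close>
  also have "\<dots> = kscale c y"
    using assms by (simp add: c kscale_mult arrow_ideal_def)
  finally show ?thesis
    using assms by (simp add: arrow_ideal_def kscale_mult)
qed

text \<open>
  With \<open>d = D(e)\<close>, the Leibniz rule for \<open>e = e e\<close> reads \<open>d = d e + e d\<close>, and multiplying it by \<open>e\<close>
  on the left gives only \<open>e d e = 0\<close>. Since \<open>d e\<close> is a multiple of \<open>e\<close>, it equals \<open>e d e\<close>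
  and so vanishes as well.
\<close>

lemma derivation_kidem_in_arrow_ideal:
  assumes "derivation D"
  shows "D kidem \<in> arrow_ideal"
proof -
  have leibniz: "D kidem = D kidem * kidem + kidem * D kidem"
    using assms unfolding derivation_def by (metis kronecker_relations(1))
  have "kidem * D kidem = kidem * (D kidem * kidem) + kidem * (kidem * D kidem)"
    using arg_cong[OF leibniz, of "(*) kidem"] by (simp only: distrib_left)
  moreover have "kidem * (kidem * D kidem) = kidem * D kidem"
    by (simp add: kronecker_relations flip: mult.assoc)
  ultimately have "kidem * (D kidem * kidem) = 0" by simp
  moreover obtain c where "D kidem * kidem = kscale c kidem"
    using mult_kidem_eq_kscale by blast
  ultimately have "D kidem * kidem = 0"
    by (simp add: kscale_mult kronecker_relations)
  then show ?thesis using leibniz by (simp add: arrow_ideal_def)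
qed

lemma karrow_in_arrow_ideal: "karrow k \<in> arrow_ideal"
  by (simp add: arrow_ideal_def kronecker_relations)

text \<open>
  Differentiating \<open>e \<alpha> = \<alpha>\<close> and \<open>\<alpha> e = 0\<close> gives the two conditions on \<open>D(\<alpha>)\<close>, because the extra terms
  \<open>D(e) \<alpha>\<close> and \<open>\<alpha> D(e)\<close> vanish as products of two elements of the ideal.
\<close>

lemma derivation_karrow_in_arrow_ideal:
  assumes "derivation D"
  shows "D (karrow k) \<in> arrow_ideal"
proof -
  have leibniz: "D (x * y) = D x * y + x * D y" for x y
    using assms by (simp add: derivation_def)
  have "D (0 + 0) = D 0 + D 0" using assms unfolding derivation_def by blast
  then have D_0: "D 0 = 0" by simp
  have e: "D kidem \<in> arrow_ideal" by (rule derivation_kidem_in_arrow_ideal[OF assms])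
  have "D (karrow k) = kidem * D (karrow k)"
    using leibniz[of kidem "karrow k"] arrow_ideal_mult_eq_0[OF e karrow_in_arrow_ideal]
    by (simp add: kronecker_relations)
  moreover have "D (karrow k) * kidem = 0"
    using leibniz[of "karrow k" kidem] arrow_ideal_mult_eq_0[OF karrow_in_arrow_ideal e]
    by (simp add: kronecker_relations D_0)
  ultimately show ?thesis by (simp add: arrow_ideal_def)
qed

lemma derivation_in_arrow_ideal:
  assumes "derivation D"
  shows "D x \<in> arrow_ideal"
proof (induction x rule: kronecker_induct)
  case (scalar c)
  have "D (1 * 1) = D 1 * 1 + 1 * D 1" using assms unfolding derivation_def by blast
  then have "D 1 = 0" by simp
  moreover have "D (kscale c 1) = kscale c (D 1)" using assms by (simp add: derivation_def)
  ultimately have "D (kscalar c) = 0" by (simp add: kscale_def)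
  then show ?case by (simp add: arrow_ideal_0)
next
  case idem
  show ?case by (rule derivation_kidem_in_arrow_ideal[OF assms])
next
  case (arrow k)
  show ?case by (rule derivation_karrow_in_arrow_ideal[OF assms])
next
  case (add x y)
  then show ?case using assms by (simp add: derivation_def arrow_ideal_add)
next
  case (mult x y)
  then show ?case
    using assms
    by (simp add: derivation_def arrow_ideal_add arrow_ideal_mult_left arrow_ideal_mult_right)
qed

lemma basic_form_eq_0:
  assumes "\<gg> \<subseteq> Collect derivation" "k \<ge> 2" "D \<in> {1..k} \<rightarrow>\<^sub>E \<gg>"
  shows "basic_form \<gg> k a D = 0"
proof -
  have "prod_list (map (\<lambda>i. differential \<gg> (a i) (D (\<sigma> i))) [1..<Suc k]) = 0"
    if \<sigma>: "\<sigma> permutes {1..k}" for \<sigma>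
  proof -
    have factor: "differential \<gg> (a i) (D (\<sigma> i)) \<in> arrow_ideal" if "i \<in> {1..k}" for i
    proof -
      have "\<sigma> i \<in> {1..k}" using permutes_in_image[OF \<sigma>] that by blast
      then have "D (\<sigma> i) \<in> \<gg>" using assms(3) by (rule PiE_mem[rotated])
      then show ?thesis
        using assms(1) by (auto simp: differential_def intro: derivation_in_arrow_ideal)
    qed
    have "differential \<gg> (a 1) (D (\<sigma> 1)) * differential \<gg> (a 2) (D (\<sigma> 2)) = 0"
      using assms(2) by (intro arrow_ideal_mult_eq_0 factor) auto
    moreover have "[1..<Suc k] = 1 # 2 # [3..<Suc k]"
      using assms(2) by (simp add: upt_conv_Cons numeral_eq_Suc)
    ultimately show ?thesis by (simp flip: mult.assoc)
  qed
  then show ?thesis using assms(3) by (simp add: basic_form_def)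
qed

theorem proposition4p7:
  fixes \<gg> :: "('n::finite kronecker \<Rightarrow> 'n kronecker) set" and k :: nat
  assumes "lie_algebra_of_derivations \<gg>"
    and "k \<ge> 2"
  shows "Omega \<gg> k = {zero_form \<gg> k}"
proof -
  have "\<gg> \<subseteq> Collect derivation"
    using assms(1) by (simp add: lie_algebra_of_derivations_def)
  then have zero: "basic_form \<gg> k a D = 0" if "D \<in> {1..k} \<rightarrow>\<^sub>E \<gg>" for a D
    using assms(2) that by (rule basic_form_eq_0)
  have "(\<lambda>D \<in> {1..k} \<rightarrow>\<^sub>E \<gg>. \<Sum>a\<leftarrow>as. basic_form \<gg> k a D) = zero_form \<gg> k" for as
    unfolding zero_form_def by (rule restrict_ext) (simp add: zero)
  then show ?thesis by (simp add: Omega_def)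
qed

end
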